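(* Let $b$ be a prime power, $m,s\in\mathbb{N}$, $t\in\mathbb{N}_0$, and let $P_N=\{\boldsymbol{x}_0,\dots,\boldsymbol{x}_{N-1}\}$ be a digital $(t,m,s)$-net in base $b$ with $N=b^m$ points. Then for any non-empty $u\subseteq\{1,\dots,s\}$ and any $\boldsymbol{k}=(k_j)_{j\in u}\in\mathbb{N}_0^{|u|}$, the gain coefficient $\Gamma_{u,\boldsymbol{k}}$ of $P_N$ satisfies: (i) $\Gamma_{u,\boldsymbol{k}}\le 0$ if $|\boldsymbol{k}|\le m-t-|u|$; (ii) $\displaystyle \Gamma_{u,\boldsymbol{k}}\le b^{m-|\boldsymbol{k}|}(b-1)^{|\boldsymbol{k}|-m+t}\le \frac{b^{t+|u|-1}}{(b-1)^{|u|-1}}$ if $m-t-|u|<|\boldsymbol{k}|\le m-t$; (iii) $\Gamma_{u,\boldsymbol{k}}\le b^t$ if $|\boldsymbol{k}|>m-t$. In particular, $\displaystyle \Gamma\le \frac{b^{t+s-1}}{(b-1)^{s-1}}$, where $\Gamma:=\max_{\emptyset\ne u\subseteq\{1,\dots,s\}}\max_{\boldsymbol{k}\in\mathbb{N}_0^{|u|}}\Gamma_{u,\boldsymbol{k}}$.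
   Context: $\mathbb{N}$ is the set of positive integers, $\mathbb{N}_0=\mathbb{N}\cup\{0\}$, $b$ is a prime power, $\mathbb{F}_b$ is the field with $b$ elements, and $\varphi:\{0,1,\dots,b-1\}\to\mathbb{F}_b$ is a fixed bijection with $\varphi(0)=0$. For a vector $\boldsymbol{k}=(k_j)_{j\in u}$ write $|\boldsymbol{k}|=\sum_{j\in u}k_j$. $(t,m,s)$-net in base $b$: a collection $P$ of $b^m$ points of $[0,1)^s$ (counted with multiplicity) such that every interval $\prod_{j=1}^s[a_jb^{-c_j},(a_j+1)b^{-c_j})$ with $c_j\in\mathbb{N}_0$, $0\le a_j<b^{c_j}$ integers and $\sum_{j=1}^s c_j=m-t$ contains exactly $b^t$ points of $P$. Digital net in base $b$: let $m,n\in\mathbb{N}$ and let $C_1,\dots,C_s\in\mathbb{F}_b^{n\times m}$ (generating matrices). For an integer $0\le h<b^m$ with $b$-adic expansion $h=\eta_0+\eta_1b+\cdots+\eta_{m-1}b^{m-1}$, set $(\xi_{1,h,j},\dots,\xi_{n,h,j})^\top=C_j(\varphi(\eta_0),\dots,\varphi(\eta_{m-1}))^\top$, $x_{h,j}=\sum_{i=1}^n\varphi^{-1}(\xi_{i,h,j})b^{-i}$, and $\boldsymbol{x}_h=(x_{h,1},\dots,x_{h,s})\in[0,1)^s$. Then $P=\{\boldsymbol{x}_h\mid 0\le h<b^m\}$ (indexed by $h$) is a digital net; it is a digital $(t,m,s)$-net if it is moreover a $(t,m,s)$-net in base $b$. Gain coefficients: for points $\boldsymbol{x}_0,\dots,\boldsymbol{x}_{N-1}\in[0,1)^s$,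 $\boldsymbol{x}_i=(x_{i,1},\dots,x_{i,s})$, non-empty $u\subseteq\{1,\dots,s\}$ and $\boldsymbol{k}=(k_j)_{j\in u}\in\mathbb{N}_0^{|u|}$, $$\Gamma_{u,\boldsymbol{k}}:=\frac1N\sum_{i,i'=0}^{N-1}\prod_{j\in u}\frac{b\,\chi(\lfloor b^{k_j+1}x_{i,j}\rfloor=\lfloor b^{k_j+1}x_{i',j}\rfloor)-\chi(\lfloor b^{k_j}x_{i,j}\rfloor=\lfloor b^{k_j}x_{i',j}\rfloor)}{b-1},$$ where $\chi(A)$ is $1$ if $A$ holds and $0$ otherwise. *)

theory Defs
  imports
    Complex_Main
    "HOL-Library.FuncSet"
    "HOL-Library.Cardinality"
    "HOL-Number_Theory.Prime_Powers"
    "Jordan_Normal_Form.Matrix"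
begin

text \<open>
  A point set of \<open>N\<close> points in dimension \<open>s\<close>, counted with multiplicity, is an indexed family
  \<open>x :: nat \<Rightarrow> nat \<Rightarrow> real\<close>: \<open>x i j\<close>, for \<open>i < N\<close> and \<open>1 \<le> j \<le> s\<close>, is the \<open>j\<close>-th coordinate
  of the \<open>i\<close>-th point; values at other indices are irrelevant.  Likewise for
  \<open>u \<subseteq> {1..s}\<close> a vector \<open>k\<close> indexed by \<open>u\<close> is a function \<open>nat \<Rightarrow> nat\<close> of which only the values
  on \<open>u\<close> are used.
\<close>

text \<open>
  The condition on \<open>c\<close> is stated in the integers, since \<open>m - t\<close> would be truncated
  in the natural numbers if \<open>t > m\<close>.
\<close>

definition tms_net :: "nat \<Rightarrow> nat \<Rightarrow> nat \<Rightarrow> nat \<Rightarrow> (nat \<Rightarrow> nat \<Rightarrow> real) \<Rightarrow> bool" where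
  "tms_net b t m s x \<longleftrightarrow>
     (\<forall>i < b ^ m. \<forall>j \<in> {1..s}. x i j \<in> {0..<1}) \<and>
     (\<forall>c a :: nat \<Rightarrow> nat.
        (\<Sum>j = 1..s. int (c j)) = int m - int t \<longrightarrow>
        (\<forall>j \<in> {1..s}. a j < b ^ c j) \<longrightarrow>
        card {i. i < b ^ m \<and>
                 (\<forall>j \<in> {1..s}. x i j \<in> {real (a j) / real b ^ c j ..< (real (a j) + 1) / real b ^ c j})}
          = b ^ t)"

text \<open>
  Vectors and matrices are indexed from \<open>0\<close> in the library, so that the digit belonging
  to \<open>b\<^sup>-\<^sup>i\<close>, \<open>1 \<le> i \<le> n\<close>, is computed from the component with index \<open>i - 1\<close>.
  The number \<open>h div b ^ r mod b\<close> is the \<open>r\<close>-th base \<open>b\<close> digit of \<open>h\<close>.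
\<close>

definition digital_point ::
  "nat \<Rightarrow> (nat \<Rightarrow> 'f :: {field, finite}) \<Rightarrow> nat \<Rightarrow> nat \<Rightarrow> (nat \<Rightarrow> 'f mat) \<Rightarrow> nat \<Rightarrow> nat \<Rightarrow> real" where
  "digital_point b \<phi> n m C h j =
     (let \<xi> = C j *\<^sub>v vec m (\<lambda>r. \<phi> (h div b ^ r mod b))
      in \<Sum>i = 1..n. real (the_inv_into {..<b} \<phi> (\<xi> $ (i - 1))) / real b ^ i)"

definition digital_net ::
  "nat \<Rightarrow> (nat \<Rightarrow> 'f :: {field, finite}) \<Rightarrow> nat \<Rightarrow> nat \<Rightarrow> (nat \<Rightarrow> nat \<Rightarrow> real) \<Rightarrow> bool" where
  "digital_net b \<phi> m s x \<longleftrightarrow>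
     (\<exists>n \<ge> 1. \<exists>C :: nat \<Rightarrow> 'f mat.
        (\<forall>j \<in> {1..s}. C j \<in> carrier_mat n m) \<and>
        (\<forall>h < b ^ m. \<forall>j \<in> {1..s}. x h j = digital_point b \<phi> n m C h j))"

definition digital_tms_net ::
  "nat \<Rightarrow> (nat \<Rightarrow> 'f :: {field, finite}) \<Rightarrow> nat \<Rightarrow> nat \<Rightarrow> nat \<Rightarrow> (nat \<Rightarrow> nat \<Rightarrow> real) \<Rightarrow> bool" where
  "digital_tms_net b \<phi> t m s x \<longleftrightarrow> digital_net b \<phi> m s x \<and> tms_net b t m s x"

definition gain_coeff ::
  "nat \<Rightarrow> nat \<Rightarrow> (nat \<Rightarrow> nat \<Rightarrow> real) \<Rightarrow> nat set \<Rightarrow> (nat \<Rightarrow> nat) \<Rightarrow> real" where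
  "gain_coeff b N x u k =
     1 / real N * (\<Sum>i<N. \<Sum>i'<N. \<Prod>j\<in>u.
       (real b * of_bool (\<lfloor>real b ^ (k j + 1) * x i j\<rfloor> = \<lfloor>real b ^ (k j + 1) * x i' j\<rfloor>)
         - of_bool (\<lfloor>real b ^ k j * x i j\<rfloor> = \<lfloor>real b ^ k j * x i' j\<rfloor>)) / (real b - 1))"

definition max_gain :: "nat \<Rightarrow> nat \<Rightarrow> nat \<Rightarrow> (nat \<Rightarrow> nat \<Rightarrow> real) \<Rightarrow> real" where
  "max_gain b N s x =
     (MAX u \<in> {u. u \<noteq> {} \<and> u \<subseteq> {1..s}}. MAX k \<in> UNIV. gain_coeff b N x u k)"

text \<open>
  Both maxima range over finite sets of values, although there are infinitely many \<open>k\<close>: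
\<close>

lemma finite_range_gain_coeff:
  assumes "finite u"
  shows "finite (range (gain_coeff b N x u))"
proof -
  let ?I = "{..<N} \<times> {..<N} \<times> u"
  define G where "G T = 1 / real N * (\<Sum>i<N. \<Sum>i'<N. \<Prod>j\<in>u.
       (real b * of_bool (fst (T (i, i', j))) - of_bool (snd (T (i, i', j)))) / (real b - 1))"
    for T :: "nat \<times> nat \<times> nat \<Rightarrow> bool \<times> bool"
  define T where "T k = restrict (\<lambda>(i, i', j).
      (\<lfloor>real b ^ (k j + 1) * x i j\<rfloor> = \<lfloor>real b ^ (k j + 1) * x i' j\<rfloor>,
       \<lfloor>real b ^ k j * x i j\<rfloor> = \<lfloor>real b ^ k j * x i' j\<rfloor>)) ?I" for k :: "nat \<Rightarrow> nat"
  have "gain_coeff b N x u k = G (T k)" for k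
    unfolding gain_coeff_def G_def
    by (intro arg_cong[where f = "(*) (1 / real N)"] sum.cong prod.cong refl) (simp add: T_def)
  moreover have "T k \<in> ?I \<rightarrow>\<^sub>E UNIV" for k
    unfolding T_def by auto
  ultimately have "range (gain_coeff b N x u) \<subseteq> G ` (?I \<rightarrow>\<^sub>E UNIV)"
    by auto
  moreover have "finite (?I \<rightarrow>\<^sub>E (UNIV :: (bool \<times> bool) set))"
    using assms by (intro finite_PiE) auto
  ultimately show ?thesis
    by (meson finite_imageI finite_subset)
qed

lemma max_gain_attained:
  assumes "s \<ge> 1"
  shows "\<exists>u k. u \<noteq> {} \<and> u \<subseteq> {1..s} \<and> max_gain b N s x = gain_coeff b N x u k"
    and "\<And>u k. u \<noteq> {} \<Longrightarrow> u \<subseteq> {1..s} \<Longrightarrow> gain_coeff b N x u k \<le> max_gain b N s x"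
proof -
  let ?U = "{u. u \<noteq> {} \<and> u \<subseteq> {1..s}}"
  let ?M = "\<lambda>u. MAX k \<in> UNIV. gain_coeff b N x u k"
  have fin: "finite ?U"
    by (rule finite_subset[of _ "Pow {1..s}"]) auto
  have ne: "?U \<noteq> {}"
    using assms by (auto intro!: exI[of _ "{1::nat}"])
  have "max_gain b N s x \<in> ?M ` ?U"
    unfolding max_gain_def using fin ne by (intro Max_in) auto
  then obtain u where u: "u \<noteq> {}" "u \<subseteq> {1..s}" "max_gain b N s x = ?M u"
    by blast
  have "finite u"
    using u(2) finite_subset by blast
  hence "?M u \<in> range (gain_coeff b N x u)"
    by (intro Max_in finite_range_gain_coeff) auto
  with u show "\<exists>u k. u \<noteq> {} \<and> u \<subseteq> {1..s} \<and> max_gain b N s x = gain_coeff b N x u k"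
    by auto
  fix u k
  assume u: "u \<noteq> {}" "u \<subseteq> {1..s}"
  have "finite u"
    using u(2) finite_subset by blast
  hence "gain_coeff b N x u k \<le> ?M u"
    by (intro Max_ge finite_range_gain_coeff) auto
  also have "?M u \<le> max_gain b N s x"
    unfolding max_gain_def using fin u by (intro Max_ge) auto
  finally show "gain_coeff b N x u k \<le> max_gain b N s x" .
qed

end

theory Submission
  imports Defs
begin

text \<open>
  Let \<open>\<chi>\<^sub>l\<close> say that two points share their \<open>j\<close>-th coordinate up to \<open>l\<close> base \<open>b\<close> digits, and put
  \<open>D\<^sub>l = b \<chi>\<^bsub>l+1\<^esub> - \<chi>\<^sub>l\<close>.  Up to the factor \<open>N * (b - 1) ^ card u\<close>, the gain coefficient is the sum
  over all pairs of points of the product of the \<open>D\<^bsub>k j\<^esub>\<close> over \<open>j \<in> u\<close>.  The proof turns such sums step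
  by step into sums of products of \<open>\<chi>\<close>'s alone, which count pairs of points in a common
  elementary interval and are governed by equidistribution.

  The key is that both \<open>\<chi>\<^sub>l\<close> and \<open>D\<^sub>l\<close> are positive semidefinite as matrices indexed by pairs of
  points, and hence so are their products over coordinates: every mixed sum, with factors
  \<open>D\<close> on a set \<open>w\<close> of coordinates and \<open>\<chi>\<close> on the others, is nonnegative (\<open>pair_sum_nonneg\<close>).  Expanding
  one factor \<open>D\<^sub>l\<close> as \<open>b \<chi>\<^bsub>l+1\<^esub> - \<chi>\<^sub>l\<close> therefore gives an upper bound by dropping the subtracted sum:
  a coordinate with a factor \<open>D\<^sub>l\<close> may be refined to \<open>\<chi>\<^bsub>l+1\<^esub>\<close> at the price of a factor \<open>b\<close>
  (\<open>pair_sum_refine\<close>).  Alternatively \<open>|D\<^sub>l| \<le> (b - 1) \<chi>\<^sub>l\<close> keeps the level at the price of \<open>b - 1\<close>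
  (\<open>pair_sum_le_same_cell\<close>).

  For a net, a sum of products of \<open>\<chi>\<close>'s with total level \<open>n\<close> equals \<open>N * b ^ (m - n)\<close> as
  long as \<open>n \<le> m - t\<close> (\<open>pair_sum_net_eq\<close>), and by monotonicity it is at most
  \<open>N * b ^ t\<close> beyond (\<open>pair_sum_net_le\<close>).  It remains to choose the set \<open>e\<close> of refined coordinates.
  If \<open>|k| > m - t\<close>, no refinement is needed.  If \<open>m - t - |u| < |k| \<le> m - t\<close>, refining
  \<open>m - t - |k|\<close> coordinates raises the total level to exactly \<open>m - t\<close>, the last level at which the
  count is still exact (\<open>gain_coeff_net_le\<close>).  If \<open>|k| \<le> m - t - |u|\<close>, refining all coordinates but one leaves
  a single factor \<open>b \<chi>\<^bsub>l+1\<^esub> - \<chi>\<^sub>l\<close> whose two terms are both exact counts and cancel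
  (\<open>gain_coeff_net_nonpos\<close>).
\<close>

section \<open>Sums of products of Gram kernels\<close>

text \<open>
  A kernel of inner products \<open>\<langle>g i, g i'\<rangle>\<close> of vectors in a finite-dimensional space.  The
  coordinates of the vectors are indexed by integers because cells of a partition of the points
  will be labelled by floors.
\<close>

definition gram_kernel :: "'i set \<Rightarrow> ('i \<Rightarrow> 'i \<Rightarrow> real) \<Rightarrow> bool" where
  "gram_kernel I K \<longleftrightarrow>
     (\<exists>(Z :: int set) g. finite Z \<and> (\<forall>i\<in>I. \<forall>i'\<in>I. K i i' = (\<Sum>z\<in>Z. g z i * g z i')))"

text \<open>
  A product of positive semidefinite kernels is positive semidefinite (Schur).  For Gram kernels
  this is an induction: the coordinates \<open>g z\<close> of one factor can be absorbed into the weights, which is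
  why arbitrary weights \<open>f\<close> are carried along.
\<close>

lemma prod_gram_kernels_nonneg:
  fixes K :: "'j \<Rightarrow> 'i \<Rightarrow> 'i \<Rightarrow> real"
  assumes "finite u" and "\<And>j. j \<in> u \<Longrightarrow> gram_kernel I (K j)"
  shows "(\<Sum>i\<in>I. \<Sum>i'\<in>I. f i * f i' * (\<Prod>j\<in>u. K j i i')) \<ge> 0"
  using assms
proof (induction u arbitrary: f rule: finite_induct)
  case empty
  have "(\<Sum>i\<in>I. \<Sum>i'\<in>I. f i * f i') = (\<Sum>i\<in>I. f i)\<^sup>2"
    by (simp add: power2_eq_square sum_product)
  thus ?case by simp
next
  case (insert a u)
  obtain Z g where Z: "finite (Z :: int set)"
    and g: "\<And>i i'. i \<in> I \<Longrightarrow> i' \<in> I \<Longrightarrow> K a i i' = (\<Sum>z\<in>Z. g z i * g z i')"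
    using insert.prems[of a] unfolding gram_kernel_def by auto
  let ?P = "\<lambda>i i'. \<Prod>j\<in>u. K j i i'"
  have "(\<Sum>i\<in>I. \<Sum>i'\<in>I. f i * f i' * (\<Prod>j\<in>insert a u. K j i i'))
      = (\<Sum>i\<in>I. \<Sum>i'\<in>I. \<Sum>z\<in>Z. (f i * g z i) * (f i' * g z i') * ?P i i')"
    using insert.hyps
    by (intro sum.cong refl)
       (simp add: g sum_distrib_left sum_distrib_right mult_ac)
  also have "\<dots> = (\<Sum>i\<in>I. \<Sum>z\<in>Z. \<Sum>i'\<in>I. (f i * g z i) * (f i' * g z i') * ?P i i')"
    by (intro sum.cong refl sum.swap)
  also have "\<dots> = (\<Sum>z\<in>Z. \<Sum>i\<in>I. \<Sum>i'\<in>I. (f i * g z i) * (f i' * g z i') * ?P i i')"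
    by (rule sum.swap)
  also have "\<dots> \<ge> 0"
    using insert.prems by (intro sum_nonneg[of Z] insert.IH) auto
  finally show ?case .
qed

lemma gram_kernel_same_label:
  fixes q :: "'i \<Rightarrow> int"
  assumes "finite I"
  shows "gram_kernel I (\<lambda>i i'. of_bool (q i = q i'))"
proof -
  have "of_bool (q i = q i') = (\<Sum>z\<in>q ` I. of_bool (q i = z) * (of_bool (q i' = z) :: real))"
    if "i \<in> I" for i i'
  proof -
    have "(\<Sum>z\<in>q ` I. of_bool (q i = z) * (of_bool (q i' = z) :: real))
        = (\<Sum>z\<in>q ` I. if z = q i then of_bool (q i = q i') else 0)"
      by (intro sum.cong) auto
    thus ?thesis using that assms by simp
  qed
  thus ?thesis
    unfolding gram_kernel_def using assms
    by (intro exI[of _ "q ` I"] exI[of _ "\<lambda>z i. of_bool (q i = z)"] conjI ballI finite_imageI)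
qed

text \<open>
  Call labels with the same quotient by \<open>b\<close> siblings.  Up to a scalar, the kernel is the Gram
  kernel of the indicators of the labels, projected orthogonally onto the functions with mean
  zero on each set of \<open>b\<close> siblings: subtracting the mean turns \<open>of_bool (q i = z)\<close> into
  \<open>of_bool (q i = z)\<close> minus \<open>1 / b\<close> times the indicator of the siblings of \<open>q i\<close>.
\<close>

lemma gram_kernel_label_detail:
  fixes q :: "'i \<Rightarrow> int" and b :: nat
  assumes "finite I" and b: "b > 0"
  shows "gram_kernel I (\<lambda>i i'. real b * of_bool (q i = q i')
           - of_bool (q i div int b = q i' div int b))"
proof -
  let ?p = "\<lambda>z. z div int b"
  \<comment> \<open>All siblings of occurring labels have to be present, including labels that no point carries.\<close>
  define Z where "Z = {z. ?p z \<in> ?p ` q ` I}"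
  define g where "g z i = (real b * of_bool (q i = z) - of_bool (?p (q i) = ?p z)) / sqrt (real b)"
    for z i
  have children: "{z. ?p z = y} = {int b * y ..< int b * y + int b}" for y
  proof -
    have "?p z = y \<longleftrightarrow> int b * y \<le> z \<and> z < int b * y + int b" for z
    proof
      assume "?p z = y"
      hence "z = int b * y + z mod int b"
        by (metis mult_div_mod_eq)
      moreover have "0 \<le> z mod int b" "z mod int b < int b"
        using b by auto
      ultimately show "int b * y \<le> z \<and> z < int b * y + int b"
        by linarith
    next
      assume "int b * y \<le> z \<and> z < int b * y + int b"
      thus "?p z = y"
        by (intro int_div_pos_eq[where r = "z - int b * y"]) auto
    qed
    thus ?thesis
      by (simp only: set_eq_iff mem_Collect_eq atLeastLessThan_iff simp_thms)
  qed
  have "Z = (\<Union>y\<in>?p ` q ` I. {z. ?p z = y})"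
    unfolding Z_def by auto
  hence fin: "finite Z"
    using assms(1) by (simp add: children)
  have "real b * of_bool (q i = q i') - of_bool (?p (q i) = ?p (q i')) = (\<Sum>z\<in>Z. g z i * g z i')"
    if i: "i \<in> I" and i': "i' \<in> I" for i i'
  proof -
    have mem: "q i \<in> Z" "q i' \<in> Z"
      using i i' by (auto simp: Z_def)
    have 1: "(\<Sum>z\<in>Z. of_bool (q i = z) * of_bool (q i' = z)) = (of_bool (q i = q i') :: real)"
    proof -
      have "(\<Sum>z\<in>Z. of_bool (q i = z) * (of_bool (q i' = z) :: real))
          = (\<Sum>z\<in>Z. if z = q i then of_bool (q i = q i') else 0)"
        by (intro sum.cong) auto
      thus ?thesis using mem fin by simp
    qed
    have 2: "(\<Sum>z\<in>Z. of_bool (q i = z) * of_bool (?p (q i') = ?p z))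
        = (of_bool (?p (q i) = ?p (q i')) :: real)"
    proof -
      have "(\<Sum>z\<in>Z. of_bool (q i = z) * (of_bool (?p (q i') = ?p z) :: real))
          = (\<Sum>z\<in>Z. if z = q i then of_bool (?p (q i) = ?p (q i')) else 0)"
        by (intro sum.cong) auto
      thus ?thesis using mem fin by simp
    qed
    have 3: "(\<Sum>z\<in>Z. of_bool (?p (q i) = ?p z) * of_bool (q i' = z))
        = (of_bool (?p (q i) = ?p (q i')) :: real)"
    proof -
      have "(\<Sum>z\<in>Z. of_bool (?p (q i) = ?p z) * (of_bool (q i' = z) :: real))
          = (\<Sum>z\<in>Z. if z = q i' then of_bool (?p (q i) = ?p (q i')) else 0)"
        by (intro sum.cong) auto
      thus ?thesis using mem fin by simp
    qed
    have 4: "(\<Sum>z\<in>Z. of_bool (?p (q i) = ?p z) * of_bool (?p (q i') = ?p z))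
        = real b * of_bool (?p (q i) = ?p (q i'))"
    proof -
      have "(\<Sum>z\<in>Z. of_bool (?p (q i) = ?p z) * (of_bool (?p (q i') = ?p z) :: real))
          = (\<Sum>z\<in>Z. if ?p z = ?p (q i) then of_bool (?p (q i) = ?p (q i')) else 0)"
        by (intro sum.cong) auto
      also have "\<dots> = (\<Sum>z\<in>Z \<inter> {z. ?p z = ?p (q i)}. of_bool (?p (q i) = ?p (q i')))"
        using fin by (simp add: sum.If_cases)
      also have "Z \<inter> {z. ?p z = ?p (q i)} = {z. ?p z = ?p (q i)}"
        using i by (auto simp: Z_def)
      finally show ?thesis
        by (simp add: children)
    qed
    have "(\<Sum>z\<in>Z. g z i * g z i') =
        (\<Sum>z\<in>Z. (real b * real b * (of_bool (q i = z) * of_bool (q i' = z))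
           - real b * (of_bool (q i = z) * of_bool (?p (q i') = ?p z))
           - real b * (of_bool (?p (q i) = ?p z) * of_bool (q i' = z))
           + of_bool (?p (q i) = ?p z) * of_bool (?p (q i') = ?p z)) / real b)"
      by (intro sum.cong refl) (simp add: g_def algebra_simps)
    also have "\<dots> = (real b * real b * of_bool (q i = q i')
           - real b * of_bool (?p (q i) = ?p (q i')) - real b * of_bool (?p (q i) = ?p (q i'))
           + real b * of_bool (?p (q i) = ?p (q i'))) / real b"
      unfolding sum_divide_distrib[symmetric] sum.distrib sum_subtractf
        sum_distrib_left[symmetric] 1 2 3 4 by simp
    also have "\<dots> = real b * of_bool (q i = q i') - of_bool (?p (q i) = ?p (q i'))"
      using b by (simp add: field_simps)
    finally show ?thesis by simp
  qed
  thus ?thesis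
    unfolding gram_kernel_def using fin by blast
qed

section \<open>Pair sums over elementary intervals\<close>

definition same_cell :: "nat \<Rightarrow> (nat \<Rightarrow> nat \<Rightarrow> real) \<Rightarrow> nat \<Rightarrow> nat \<Rightarrow> nat \<Rightarrow> nat \<Rightarrow> real" where
  "same_cell b x j l i i' = of_bool (\<lfloor>real b ^ l * x i j\<rfloor> = \<lfloor>real b ^ l * x i' j\<rfloor>)"

definition cell_detail :: "nat \<Rightarrow> (nat \<Rightarrow> nat \<Rightarrow> real) \<Rightarrow> nat \<Rightarrow> nat \<Rightarrow> nat \<Rightarrow> nat \<Rightarrow> real" where
  "cell_detail b x j l i i' = real b * same_cell b x j (l + 1) i i' - same_cell b x j l i i'"

text \<open>
  The set \<open>w\<close> marks the coordinates that carry the oscillating factor \<open>b \<chi>\<^bsub>l+1\<^esub> - \<chi>\<^sub>l\<close> of a gain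
  coefficient; the remaining ones only ask for a common cell.
\<close>

definition pair_sum ::
  "nat \<Rightarrow> nat \<Rightarrow> (nat \<Rightarrow> nat \<Rightarrow> real) \<Rightarrow> nat set \<Rightarrow> nat set \<Rightarrow> (nat \<Rightarrow> nat) \<Rightarrow> real" where
  "pair_sum b N x u w c = (\<Sum>i<N. \<Sum>i'<N. \<Prod>j\<in>u.
     if j \<in> w then cell_detail b x j (c j) i i' else same_cell b x j (c j) i i')"

lemma gain_coeff_eq_pair_sum:
  "gain_coeff b N x u k = pair_sum b N x u u k / (real N * (real b - 1) ^ card u)"
proof -
  have "(\<Sum>i<N. \<Sum>i'<N. \<Prod>j\<in>u.
       (real b * of_bool (\<lfloor>real b ^ (k j + 1) * x i j\<rfloor> = \<lfloor>real b ^ (k j + 1) * x i' j\<rfloor>)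
         - of_bool (\<lfloor>real b ^ k j * x i j\<rfloor> = \<lfloor>real b ^ k j * x i' j\<rfloor>)) / (real b - 1))
     = pair_sum b N x u u k / (real b - 1) ^ card u"
    unfolding pair_sum_def sum_divide_distrib
    by (intro sum.cong refl) (simp add: cell_detail_def same_cell_def prod_dividef)
  thus ?thesis by (simp add: gain_coeff_def)
qed

lemma floor_parent_cell:
  assumes "b > 0"
  shows "\<lfloor>real b ^ (l + 1) * y\<rfloor> div int b = \<lfloor>real b ^ l * y\<rfloor>"
proof -
  have "\<lfloor>real b ^ (l + 1) * y\<rfloor> div int b = \<lfloor>real b ^ (l + 1) * y / real_of_int (int b)\<rfloor>"
    by (rule floor_divide_real_eq_div[symmetric]) simp
  also have "real b ^ (l + 1) * y / real_of_int (int b) = real b ^ l * y"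
    using assms by simp
  finally show ?thesis .
qed

lemma pair_sum_nonneg:
  assumes "finite u" "b > 0"
  shows "pair_sum b N x u w c \<ge> 0"
proof -
  let ?K = "\<lambda>j i i'. if j \<in> w then cell_detail b x j (c j) i i' else same_cell b x j (c j) i i'"
  have "gram_kernel {..<N} (?K j)" for j
  proof (cases "j \<in> w")
    case True
    have "gram_kernel {..<N} (cell_detail b x j (c j))"
      using gram_kernel_label_detail[of "{..<N}" b "\<lambda>i. \<lfloor>real b ^ (c j + 1) * x i j\<rfloor>"] assms(2)
      unfolding floor_parent_cell[OF assms(2)] cell_detail_def[abs_def] same_cell_def by simp
    thus ?thesis using True by simp
  next
    case False
    thus ?thesis
      using gram_kernel_same_label[of "{..<N}" "\<lambda>i. \<lfloor>real b ^ c j * x i j\<rfloor>"]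
      by (simp add: same_cell_def)
  qed
  from prod_gram_kernels_nonneg[where f = "\<lambda>_. 1", OF assms(1) this]
  show ?thesis by (simp add: pair_sum_def)
qed

lemma pair_sum_split:
  assumes "finite u" "j \<in> u" "j \<in> w"
  shows "pair_sum b N x u w c =
    real b * pair_sum b N x u (w - {j}) (c(j := c j + 1)) - pair_sum b N x u (w - {j}) c"
proof -
  let ?F = "\<lambda>w c i i' j. if j \<in> w then cell_detail b x j (c j) i i' else same_cell b x j (c j) i i'"
  have "prod (?F w c i i') u = real b * prod (?F (w - {j}) (c(j := c j + 1)) i i') u
      - prod (?F (w - {j}) c i i') u" for i i'
  proof -
    have rest: "prod (?F (w - {j}) (c(j := c j + 1)) i i') (u - {j}) = prod (?F w c i i') (u - {j})"
      "prod (?F (w - {j}) c i i') (u - {j}) = prod (?F w c i i') (u - {j})"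
      by (intro prod.cong; simp)+
    have at_j: "?F w c i i' j = real b * ?F (w - {j}) (c(j := c j + 1)) i i' j - ?F (w - {j}) c i i' j"
      using assms(3) by (simp add: cell_detail_def)
    show ?thesis
      unfolding prod.remove[OF assms(1,2)] rest at_j by (simp only: left_diff_distrib mult.assoc)
  qed
  thus ?thesis
    by (simp only: pair_sum_def sum_subtractf sum_distrib_left)
qed

text \<open>
  The subtracted term of each expansion is a pair sum again, hence nonnegative, and can be dropped.
\<close>

lemma pair_sum_refine:
  assumes "finite u" "b > 0" "e \<subseteq> w" "w \<subseteq> u"
  shows "pair_sum b N x u w c
    \<le> real b ^ card e * pair_sum b N x u (w - e) (\<lambda>j. c j + of_bool (j \<in> e))"
proof -
  have "finite e"
    using assms(1,3,4) by (meson finite_subset)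
  thus ?thesis using assms(3)
  proof (induction e rule: finite_induct)
    case (insert a e)
    let ?c = "\<lambda>j. c j + of_bool (j \<in> e)"
    have "pair_sum b N x u (w - e) ?c
        = real b * pair_sum b N x u (w - e - {a}) (?c(a := ?c a + 1))
          - pair_sum b N x u (w - e - {a}) ?c"
      using insert assms by (intro pair_sum_split) auto
    also have "\<dots> \<le> real b * pair_sum b N x u (w - e - {a}) (?c(a := ?c a + 1))"
      using pair_sum_nonneg assms by simp
    also have "?c(a := ?c a + 1) = (\<lambda>j. c j + of_bool (j \<in> insert a e))"
      using insert.hyps by auto
    also have "w - e - {a} = w - insert a e"
      by auto
    finally have "real b ^ card e * pair_sum b N x u (w - e) ?c \<le> real b ^ card e *
        (real b * pair_sum b N x u (w - insert a e) (\<lambda>j. c j + of_bool (j \<in> insert a e)))"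
      by (intro mult_left_mono) auto
    with insert show ?case
      by (simp add: mult_ac)
  qed simp
qed

text \<open>
  Inside a common cell of level \<open>l\<close> the oscillating factor is \<open>b - 1\<close> or \<open>-1\<close>, and outside it vanishes.
\<close>

lemma pair_sum_le_same_cell:
  assumes "finite u" "b \<ge> 2" "w \<subseteq> u"
  shows "pair_sum b N x u w c \<le> (real b - 1) ^ card w * pair_sum b N x u {} c"
proof -
  have detail: "\<bar>cell_detail b x j l i i'\<bar> \<le> (real b - 1) * same_cell b x j l i i'" for j l i i'
  proof -
    have "\<lfloor>real b ^ l * x i j\<rfloor> = \<lfloor>real b ^ l * x i' j\<rfloor>"
      if "\<lfloor>real b ^ (l + 1) * x i j\<rfloor> = \<lfloor>real b ^ (l + 1) * x i' j\<rfloor>"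
      using that assms(2) floor_parent_cell[of b l] by (metis not_numeral_le_zero zero_less_iff_neq_zero)
    thus ?thesis
      using assms(2) by (auto simp: cell_detail_def same_cell_def)
  qed
  have "(\<Prod>j\<in>u. if j \<in> w then cell_detail b x j (c j) i i' else same_cell b x j (c j) i i')
      \<le> (real b - 1) ^ card w * (\<Prod>j\<in>u. same_cell b x j (c j) i i')" for i i'
  proof -
    let ?f = "\<lambda>j. if j \<in> w then cell_detail b x j (c j) i i' else same_cell b x j (c j) i i'"
    have "prod ?f u \<le> (\<Prod>j\<in>u. \<bar>?f j\<bar>)"
      using abs_prod[of ?f u] abs_ge_self[of "prod ?f u"] by linarith
    also have "\<dots> \<le> (\<Prod>j\<in>u. (if j \<in> w then real b - 1 else 1) * same_cell b x j (c j) i i')"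
      using detail by (intro prod_mono) (auto simp: same_cell_def)
    also have "\<dots> = (\<Prod>j\<in>u. if j \<in> w then real b - 1 else 1) * (\<Prod>j\<in>u. same_cell b x j (c j) i i')"
      by (rule prod.distrib)
    also have "(\<Prod>j\<in>u. if j \<in> w then real b - 1 else 1) = (real b - 1) ^ card w"
      using assms by (simp add: prod.If_cases Int_absorb1 Collect_mem_eq)
    finally show ?thesis .
  qed
  thus ?thesis
    unfolding pair_sum_def sum_distrib_left by (intro sum_mono) simp
qed

section \<open>Equidistribution of nets\<close>

lemma in_cell_iff_floor:
  assumes "b > 0"
  shows "y \<in> {real a / real b ^ l ..< (real a + 1) / real b ^ l} \<longleftrightarrow> \<lfloor>real b ^ l * y\<rfloor> = int a"
  using assms by (auto simp: floor_eq_iff field_simps)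

lemma tms_net_floor:
  assumes "tms_net b t m s x" "b > 0" "(\<Sum>j = 1..s. int (c j)) = int m - int t"
    and "\<And>j. j \<in> {1..s} \<Longrightarrow> a j < b ^ c j"
  shows "card {i. i < b ^ m \<and> (\<forall>j\<in>{1..s}. \<lfloor>real b ^ c j * x i j\<rfloor> = int (a j))} = b ^ t"
proof -
  have "\<forall>j\<in>{1..s}. a j < b ^ c j"
    using assms(4) by blast
  with assms(1,3) show ?thesis
    by (simp only: tms_net_def in_cell_iff_floor[OF assms(2)])
qed

text \<open>
  An elementary interval is the disjoint union of the \<open>b\<close> intervals obtained by fixing one more
  digit in a coordinate, each of which holds \<open>b ^ t\<close> points.
\<close>

lemma tms_net_Suc:
  assumes net: "tms_net b t m s x" and "b > 0" "s \<ge> 1"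
  shows "tms_net b (Suc t) m s x"
  unfolding tms_net_def in_cell_iff_floor[OF assms(2)]
proof (intro conjI allI impI ballI)
  show "x i j \<in> {0..<1}" if "i < b ^ m" "j \<in> {1..s}" for i j
    using net that by (simp add: tms_net_def)
next
  fix c a :: "nat \<Rightarrow> nat"
  assume c: "(\<Sum>j = 1..s. int (c j)) = int m - int (Suc t)" and a: "\<forall>j\<in>{1..s}. a j < b ^ c j"
  let ?c = "c(1 := c 1 + 1)"
  let ?a = "\<lambda>r. a(1 := b * a 1 + r)"
  let ?A = "\<lambda>r. {i. i < b ^ m \<and> (\<forall>j\<in>{1..s}. \<lfloor>real b ^ ?c j * x i j\<rfloor> = int (?a r j))}"
  have 1: "1 \<in> {1..s}"
    using \<open>s \<ge> 1\<close> by simp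
  have "(\<Sum>j = 1..s. int (?c j)) = (\<Sum>j = 1..s. int (c j) + of_bool (j = 1))"
    by (intro sum.cong) auto
  also have "\<dots> = int m - int t"
    using c 1 by (simp add: sum.distrib)
  finally have c': "(\<Sum>j = 1..s. int (?c j)) = int m - int t" .
  have card: "card (?A r) = b ^ t" if "r < b" for r
  proof (rule tms_net_floor[OF net \<open>b > 0\<close> c'])
    fix j assume "j \<in> {1..s}"
    have "b * a 1 + r < b * (a 1 + 1)"
      using that by simp
    also have "\<dots> \<le> b * b ^ c 1"
      using a 1 by (intro mult_left_mono) (auto simp: Suc_le_eq)
    finally show "?a r j < b ^ ?c j"
      using a \<open>j \<in> {1..s}\<close> by auto
  qed
  have split: "\<lfloor>real b ^ l * y\<rfloor> = int p \<longleftrightarrow> (\<exists>r<b. \<lfloor>real b ^ (l + 1) * y\<rfloor> = int (b * p + r))"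
    for l p y
  proof -
    let ?z = "\<lfloor>real b ^ (l + 1) * y\<rfloor>"
    have "?z div int b = int p \<longleftrightarrow> (\<exists>r<b. ?z = int (b * p + r))"
    proof
      assume *: "?z div int b = int p"
      have "?z = int b * int p + ?z mod int b"
        unfolding *[symmetric] by (rule mult_div_mod_eq[symmetric])
      moreover have "0 \<le> ?z mod int b" "?z mod int b < int b"
        using \<open>b > 0\<close> by auto
      ultimately show "\<exists>r<b. ?z = int (b * p + r)"
        by (intro exI[of _ "nat (?z mod int b)"]) (auto simp: nat_less_iff)
    next
      assume "\<exists>r<b. ?z = int (b * p + r)"
      then obtain r where r: "r < b" "?z = int (b * p + r)"
        by blast
      have "(b * p + r) div b = p"
        using r(1) by simp
      thus "?z div int b = int p"
        unfolding r(2) by (metis zdiv_int)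
    qed
    thus ?thesis
      by (simp only: floor_parent_cell[OF \<open>b > 0\<close>])
  qed
  have all: "(\<forall>j\<in>{1..s}. P j) \<longleftrightarrow> P 1 \<and> (\<forall>j\<in>{1..s} - {1}. P j)" for P
    using 1 by blast
  have upd: "(\<forall>j\<in>{1..s}. \<lfloor>real b ^ ?c j * x i j\<rfloor> = int (?a r j)) \<longleftrightarrow>
      \<lfloor>real b ^ (c 1 + 1) * x i 1\<rfloor> = int (b * a 1 + r) \<and>
      (\<forall>j\<in>{1..s} - {1}. \<lfloor>real b ^ c j * x i j\<rfloor> = int (a j))" for i r
    unfolding all by (intro arg_cong2[where f = conj] ball_cong) auto
  have "{i. i < b ^ m \<and> (\<forall>j\<in>{1..s}. \<lfloor>real b ^ c j * x i j\<rfloor> = int (a j))} = (\<Union>r<b. ?A r)"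
    unfolding upd all[of "\<lambda>j. \<lfloor>real b ^ c j * x _ j\<rfloor> = int (a j)"] split[of "c 1" _ "a 1"]
    by blast
  hence "card {i. i < b ^ m \<and> (\<forall>j\<in>{1..s}. \<lfloor>real b ^ c j * x i j\<rfloor> = int (a j))}
      = card (\<Union>r<b. ?A r)"
    by (rule arg_cong)
  also have "\<dots> = (\<Sum>r<b. card (?A r))"
    unfolding upd by (intro card_UN_disjoint) auto
  also have "\<dots> = (\<Sum>r<b. b ^ t)"
    by (rule sum.cong[OF refl], rule card) (simp only: lessThan_iff)
  also have "\<dots> = b ^ Suc t"
    by simp
  finally show "card {i. i < b ^ m \<and> (\<forall>j\<in>{1..s}. \<lfloor>real b ^ c j * x i j\<rfloor> = int (a j))} = b ^ Suc t" .
qed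

lemma tms_net_mono:
  assumes "tms_net b t m s x" "b > 0" "s \<ge> 1" "t \<le> t'"
  shows "tms_net b t' m s x"
  using assms(4,1) by (induction rule: dec_induct) (auto intro: tms_net_Suc assms(2,3))

text \<open>
  Since the intervals may be trivial in the coordinates outside \<open>u\<close>, each point shares its interval
  with exactly \<open>b ^ (m - \<Sum>c)\<close> points, once the net is read with the quality parameter \<open>m - \<Sum>c \<ge> t\<close>.
\<close>

lemma pair_sum_net_eq:
  assumes net: "tms_net b t m s x" and "b > 0" "s \<ge> 1" "u \<subseteq> {1..s}"
    and t: "t + (\<Sum>j\<in>u. c j) \<le> m"
  shows "pair_sum b (b ^ m) x u {} c = real (b ^ m) * real b ^ (m - (\<Sum>j\<in>u. c j))"
proof -
  let ?c = "\<lambda>j. if j \<in> u then c j else 0"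
  let ?t = "m - (\<Sum>j\<in>u. c j)"
  have net': "tms_net b ?t m s x"
    using t by (intro tms_net_mono[OF net \<open>b > 0\<close> \<open>s \<ge> 1\<close>]) simp
  have x01: "x i j \<in> {0..<1}" if "i < b ^ m" "j \<in> {1..s}" for i j
    using net that by (simp add: tms_net_def)
  have "(\<Sum>j = 1..s. ?c j) = (\<Sum>j\<in>u. c j)"
    using \<open>u \<subseteq> {1..s}\<close> by (simp add: sum.If_cases Int_absorb1)
  hence sum_c: "(\<Sum>j = 1..s. int (?c j)) = int m - int ?t"
    using t by (simp flip: of_nat_sum)
  have fin: "finite u"
    using \<open>u \<subseteq> {1..s}\<close> finite_subset by blast
  have "(\<Sum>i'<b ^ m. \<Prod>j\<in>u. same_cell b x j (c j) i i') = real b ^ ?t" if i: "i < b ^ m" for i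
  proof -
    define a where "a j = nat \<lfloor>real b ^ ?c j * x i j\<rfloor>" for j
    have a: "\<lfloor>real b ^ ?c j * x i j\<rfloor> = int (a j)" and a_less: "a j < b ^ ?c j"
      if "j \<in> {1..s}" for j
    proof -
      have x: "0 \<le> x i j" "x i j < 1"
        using x01[OF i that] by auto
      show eq: "\<lfloor>real b ^ ?c j * x i j\<rfloor> = int (a j)"
        unfolding a_def using x(1) by (simp add: le_floor_iff)
      have "real b ^ ?c j * x i j < real b ^ ?c j * 1"
        using x(2) \<open>b > 0\<close> by (intro mult_strict_left_mono) auto
      hence "\<lfloor>real b ^ ?c j * x i j\<rfloor> < int (b ^ ?c j)"
        by (simp add: floor_less_iff)
      thus "a j < b ^ ?c j"
        unfolding eq by (simp only: of_nat_less_iff)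
    qed
    have same: "(\<Prod>j\<in>u. same_cell b x j (c j) i i') =
        of_bool (\<forall>j\<in>{1..s}. \<lfloor>real b ^ ?c j * x i' j\<rfloor> = int (a j))" if i': "i' < b ^ m" for i'
    proof -
      have triv: "\<lfloor>x i j\<rfloor> = 0" "\<lfloor>x i' j\<rfloor> = 0" if "j \<in> {1..s}" for j
        using x01[OF i that] x01[OF i' that] by (auto simp: floor_eq_iff)
      have "(\<forall>j\<in>{1..s}. \<lfloor>real b ^ ?c j * x i' j\<rfloor> = int (a j)) \<longleftrightarrow>
          (\<forall>j\<in>{1..s}. \<lfloor>real b ^ ?c j * x i j\<rfloor> = \<lfloor>real b ^ ?c j * x i' j\<rfloor>)"
        using a by auto
      also have "\<dots> \<longleftrightarrow> (\<forall>j\<in>u. \<lfloor>real b ^ c j * x i j\<rfloor> = \<lfloor>real b ^ c j * x i' j\<rfloor>)"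
        using \<open>u \<subseteq> {1..s}\<close> triv by (auto split: if_splits)
      finally show ?thesis
        using fin by (auto simp: same_cell_def intro!: prod.neutral)
    qed
    have "(\<Sum>i'<b ^ m. \<Prod>j\<in>u. same_cell b x j (c j) i i') =
        (\<Sum>i'<b ^ m. of_bool (\<forall>j\<in>{1..s}. \<lfloor>real b ^ ?c j * x i' j\<rfloor> = int (a j)))"
      by (intro sum.cong) (auto simp: same)
    also have "\<dots> = real (card {i'. i' < b ^ m \<and>
        (\<forall>j\<in>{1..s}. \<lfloor>real b ^ ?c j * x i' j\<rfloor> = int (a j))})"
      by (simp add: sum.If_cases of_bool_def Int_def)
    also have "\<dots> = real b ^ ?t"
      using tms_net_floor[OF net' \<open>b > 0\<close> sum_c a_less] by simp
    finally show ?thesis .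
  qed
  thus ?thesis
    by (simp add: pair_sum_def)
qed

lemma pair_sum_same_cell_mono:
  assumes "b > 0" "\<And>j. j \<in> u \<Longrightarrow> c j \<le> c' j"
  shows "pair_sum b N x u {} c' \<le> pair_sum b N x u {} c"
proof -
  have step: "\<lfloor>real b ^ l * y\<rfloor> = \<lfloor>real b ^ l * z\<rfloor>"
    if "l \<le> l'" "\<lfloor>real b ^ l' * y\<rfloor> = \<lfloor>real b ^ l' * z\<rfloor>" for l l' y z
    using that
  proof (induction rule: dec_induct)
    case (step n)
    from step.prems have "\<lfloor>real b ^ n * y\<rfloor> = \<lfloor>real b ^ n * z\<rfloor>"
      unfolding floor_parent_cell[OF \<open>b > 0\<close>, of n y, symmetric]
        floor_parent_cell[OF \<open>b > 0\<close>, of n z, symmetric]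
      by (simp only: Suc_eq_plus1)
    thus ?case by (rule step.IH)
  qed
  have of_bool_mono: "of_bool P \<le> (of_bool Q :: real)" if "P \<Longrightarrow> Q" for P Q
    using that by simp
  have le: "same_cell b x j (c' j) i i' \<le> same_cell b x j (c j) i i'" if "j \<in> u" for j i i'
    unfolding same_cell_def by (intro of_bool_mono step[OF assms(2)[OF that]])
  have nonneg: "0 \<le> same_cell b x j l i i'" for j l i i'
    by (simp add: same_cell_def)
  have "(\<Prod>j\<in>u. same_cell b x j (c' j) i i') \<le> (\<Prod>j\<in>u. same_cell b x j (c j) i i')" for i i'
    by (intro prod_mono conjI nonneg le)
  thus ?thesis
    unfolding pair_sum_def by (intro sum_mono) simp
qed

lemma exists_smaller_with_sum:
  fixes k :: "'j \<Rightarrow> nat"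
  assumes "finite u" "n \<le> (\<Sum>j\<in>u. k j)"
  shows "\<exists>c. (\<forall>j\<in>u. c j \<le> k j) \<and> (\<Sum>j\<in>u. c j) = n"
  using assms
proof (induction u arbitrary: n rule: finite_induct)
  case (insert a u)
  have "n - min n (k a) \<le> sum k u"
    using insert by auto
  then obtain c where c: "\<forall>j\<in>u. c j \<le> k j" "sum c u = n - min n (k a)"
    using insert.IH by blast
  have "sum (c(a := min n (k a))) u = sum c u"
    using insert.hyps by (intro sum.cong) auto
  hence "sum (c(a := min n (k a))) (insert a u) = n"
    using insert.hyps c(2) by simp
  with c(1) show ?case
    by (intro exI[of _ "c(a := min n (k a))"]) auto
qed simp

text \<open>
  Too fine a partition is coarsened to one of total level \<open>m - t\<close>, where the count is exact.  If
  \<open>t > m\<close>, no interval is controlled, but then \<open>b ^ t\<close> exceeds the number of points.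
\<close>

lemma pair_sum_net_le:
  assumes net: "tms_net b t m s x" and "b > 0" "s \<ge> 1" "u \<subseteq> {1..s}"
    and k: "m \<le> t + (\<Sum>j\<in>u. k j)"
  shows "pair_sum b (b ^ m) x u {} k \<le> real (b ^ m) * real b ^ t"
proof -
  have fin: "finite u"
    using \<open>u \<subseteq> {1..s}\<close> finite_subset by blast
  have "m - t \<le> (\<Sum>j\<in>u. k j)"
    using k by simp
  then obtain c where c: "\<And>j. j \<in> u \<Longrightarrow> c j \<le> k j" "(\<Sum>j\<in>u. c j) = m - t"
    using exists_smaller_with_sum[OF fin] by metis
  have "pair_sum b (b ^ m) x u {} k \<le> pair_sum b (b ^ m) x u {} c"
    by (rule pair_sum_same_cell_mono[OF \<open>b > 0\<close> c(1)])
  also have "\<dots> \<le> real (b ^ m) * real b ^ t"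
  proof (cases "t \<le> m")
    case True
    thus ?thesis
      using pair_sum_net_eq[OF net \<open>b > 0\<close> \<open>s \<ge> 1\<close> \<open>u \<subseteq> {1..s}\<close>, of c] c(2) by simp
  next
    case False
    have "(\<Prod>j\<in>u. same_cell b x j (c j) i i') \<le> 1" for i i'
      by (intro prod_le_1) (auto simp: same_cell_def)
    hence "pair_sum b (b ^ m) x u {} c \<le> (\<Sum>i<b ^ m. \<Sum>i'<b ^ m. 1)"
      unfolding pair_sum_def by (intro sum_mono) simp
    also have "\<dots> = real (b ^ m) * real b ^ m"
      by simp
    also have "\<dots> \<le> real (b ^ m) * real b ^ t"
      using False \<open>b > 0\<close> by (intro mult_left_mono power_increasing) auto
    finally show ?thesis .
  qed
  finally show ?thesis .
qed

section \<open>Gain coefficients\<close>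

lemma sum_add_of_bool:
  fixes k :: "'j \<Rightarrow> nat"
  assumes "finite u" "e \<subseteq> u"
  shows "(\<Sum>j\<in>u. k j + of_bool (j \<in> e)) = (\<Sum>j\<in>u. k j) + card e"
  using assms by (simp add: sum.distrib sum.If_cases of_bool_def Int_absorb1)

text \<open>
  The coordinates in \<open>e\<close> are refined, costing \<open>b\<close> each instead of the \<open>b - 1\<close> paid for the others.
  After division by \<open>(b - 1) ^ card u\<close> only the ratios \<open>b / (b - 1)\<close> for \<open>e\<close> survive, so \<open>e\<close> should be
  as small as the premise allows.
\<close>

lemma gain_coeff_net_le:
  assumes net: "tms_net b t m s x" and b: "b \<ge> 2" and "s \<ge> 1" "u \<subseteq> {1..s}" "e \<subseteq> u"
    and k: "m \<le> t + (\<Sum>j\<in>u. k j) + card e"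
  shows "gain_coeff b (b ^ m) x u k \<le> real b ^ (t + card e) / (real b - 1) ^ card e"
proof -
  have fin: "finite u"
    using \<open>u \<subseteq> {1..s}\<close> finite_subset by blast
  hence card: "card u = card e + card (u - e)"
    using \<open>e \<subseteq> u\<close> by (metis card_Diff_subset card_mono finite_subset le_add_diff_inverse)
  let ?k = "\<lambda>j. k j + of_bool (j \<in> e)"
  have sum: "(\<Sum>j\<in>u. ?k j) = (\<Sum>j\<in>u. k j) + card e"
    using fin \<open>e \<subseteq> u\<close> by (rule sum_add_of_bool)
  have "pair_sum b (b ^ m) x u u k \<le> real b ^ card e * pair_sum b (b ^ m) x u (u - e) ?k"
    using fin b \<open>e \<subseteq> u\<close> by (intro pair_sum_refine) auto
  also have "\<dots> \<le> real b ^ card e *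
      ((real b - 1) ^ card (u - e) * pair_sum b (b ^ m) x u {} ?k)"
    using fin b by (intro mult_left_mono pair_sum_le_same_cell) auto
  also have "\<dots> \<le> real b ^ card e * ((real b - 1) ^ card (u - e) * (real (b ^ m) * real b ^ t))"
    using b sum k \<open>s \<ge> 1\<close> \<open>u \<subseteq> {1..s}\<close>
    by (intro mult_left_mono pair_sum_net_le[OF net]) auto
  finally show ?thesis
    using b by (simp add: gain_coeff_eq_pair_sum card power_add field_simps)
qed

text \<open>
  With all coordinates but \<open>a\<close> refined, the last factor is kept as a difference: raising the level of \<open>a\<close>
  by one divides the exact count by \<open>b\<close>, so the two terms cancel.
\<close>

lemma gain_coeff_net_nonpos:
  assumes net: "tms_net b t m s x" and b: "b \<ge> 2" and "s \<ge> 1" "u \<subseteq> {1..s}" "u \<noteq> {}"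
    and k: "t + (\<Sum>j\<in>u. k j) + card u \<le> m"
  shows "gain_coeff b (b ^ m) x u k \<le> 0"
proof -
  have fin: "finite u"
    using \<open>u \<subseteq> {1..s}\<close> finite_subset by blast
  obtain a where a: "a \<in> u"
    using \<open>u \<noteq> {}\<close> by blast
  let ?e = "u - {a}"
  let ?k = "\<lambda>j. k j + of_bool (j \<in> ?e)"
  have card: "card u = card ?e + 1"
    using card.remove[OF fin a] by simp
  have sum: "(\<Sum>j\<in>u. ?k j) = (\<Sum>j\<in>u. k j) + card ?e"
    using fin by (intro sum_add_of_bool) auto
  have sum': "(\<Sum>j\<in>u. (?k(a := ?k a + 1)) j) = (\<Sum>j\<in>u. ?k j) + 1"
  proof -
    have "?k(a := ?k a + 1) = (\<lambda>j. ?k j + of_bool (j \<in> {a}))"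
      by auto
    thus ?thesis
      using sum_add_of_bool[OF fin, of "{a}" ?k] a by simp
  qed
  have le: "t + (\<Sum>j\<in>u. ?k j) + 1 \<le> m"
    using k sum card by simp
  have "pair_sum b (b ^ m) x u u k \<le> real b ^ card ?e * pair_sum b (b ^ m) x u (u - ?e) ?k"
    using fin b by (intro pair_sum_refine) auto
  also have "u - ?e = {a}"
    using a by auto
  also have "pair_sum b (b ^ m) x u {a} ?k = 0"
  proof -
    have "pair_sum b (b ^ m) x u {} (?k(a := ?k a + 1))
        = real (b ^ m) * real b ^ (m - ((\<Sum>j\<in>u. ?k j) + 1))"
      unfolding sum'[symmetric]
      by (rule pair_sum_net_eq[OF net _ \<open>s \<ge> 1\<close> \<open>u \<subseteq> {1..s}\<close>]) (use b le sum' in linarith)+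
    moreover have "pair_sum b (b ^ m) x u {} ?k = real (b ^ m) * real b ^ (m - (\<Sum>j\<in>u. ?k j))"
      by (rule pair_sum_net_eq[OF net _ \<open>s \<ge> 1\<close> \<open>u \<subseteq> {1..s}\<close>]) (use b le in linarith)+
    moreover have "m - (\<Sum>j\<in>u. ?k j) = Suc (m - ((\<Sum>j\<in>u. ?k j) + 1))"
      using le by linarith
    ultimately show ?thesis
      unfolding pair_sum_split[OF fin a singletonI] Diff_cancel by (simp only: power_Suc) simp
  qed
  finally have "pair_sum b (b ^ m) x u u k \<le> 0"
    by simp
  thus ?thesis
    using b by (simp add: gain_coeff_eq_pair_sum divide_nonpos_nonneg)
qed

lemma gain_bound_mono:
  assumes "b \<ge> (2 :: nat)" "d \<le> d'"
  shows "real b ^ (t + d) / (real b - 1) ^ d \<le> real b ^ (t + d') / (real b - 1) ^ d'"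
proof -
  have "(real b / (real b - 1)) ^ d \<le> (real b / (real b - 1)) ^ d'"
    using assms by (intro power_increasing) (auto simp: field_simps)
  hence "real b ^ t * (real b / (real b - 1)) ^ d \<le> real b ^ t * (real b / (real b - 1)) ^ d'"
    by (intro mult_left_mono) auto
  thus ?thesis by (simp add: power_add power_divide)
qed

theorem theorem3p5:
  fixes b m s t N :: nat
    and \<phi> :: "nat \<Rightarrow> 'f :: {field, finite}"
    and x :: "nat \<Rightarrow> nat \<Rightarrow> real"
  assumes "primepow b" and "CARD('f) = b"
    and "bij_betw \<phi> {..<b} UNIV" and "\<phi> 0 = 0"
    and "m \<ge> 1" and "s \<ge> 1"
    and "N = b ^ m"
    and "digital_tms_net b \<phi> t m s x"
  shows "(\<forall>(u :: nat set) (k :: nat \<Rightarrow> nat). u \<noteq> {} \<longrightarrow> u \<subseteq> {1..s} \<longrightarrow>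
            (int (\<Sum>j\<in>u. k j) \<le> int m - int t - int (card u) \<longrightarrow>
               gain_coeff b N x u k \<le> 0) \<and>
            (int m - int t - int (card u) < int (\<Sum>j\<in>u. k j) \<and>
             int (\<Sum>j\<in>u. k j) \<le> int m - int t \<longrightarrow>
               gain_coeff b N x u k
                 \<le> real b powi (int m - int (\<Sum>j\<in>u. k j))
                    * (real b - 1) powi (int (\<Sum>j\<in>u. k j) - int m + int t) \<and>
               real b powi (int m - int (\<Sum>j\<in>u. k j))
                    * (real b - 1) powi (int (\<Sum>j\<in>u. k j) - int m + int t)
                 \<le> real b ^ (t + card u - 1) / (real b - 1) ^ (card u - 1)) \<and>
            (int (\<Sum>j\<in>u. k j) > int m - int t \<longrightarrow>
               gain_coeff b N x u k \<le> real b ^ t)) \<and>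
         max_gain b N s x \<le> real b ^ (t + s - 1) / (real b - 1) ^ (s - 1)"
proof -
  have b: "b \<ge> 2"
    using primepow_gt_Suc_0[OF assms(1)] by simp
  have net: "tms_net b t m s x"
    using assms(8) by (simp add: digital_tms_net_def)
  have i: "gain_coeff b N x u k \<le> 0"
    if "u \<noteq> {}" "u \<subseteq> {1..s}" "int (\<Sum>j\<in>u. k j) \<le> int m - int t - int (card u)" for u k
    unfolding \<open>N = b ^ m\<close> using that
    by (intro gain_coeff_net_nonpos[OF net b \<open>s \<ge> 1\<close>]) linarith+
  have iii: "gain_coeff b N x u k \<le> real b ^ t"
    if "u \<noteq> {}" "u \<subseteq> {1..s}" "int (\<Sum>j\<in>u. k j) > int m - int t" for u k
    using gain_coeff_net_le[OF net b \<open>s \<ge> 1\<close> that(2), of "{}" k] that(3)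
    unfolding \<open>N = b ^ m\<close> by simp
  have ii: "gain_coeff b N x u k
        \<le> real b powi (int m - int (\<Sum>j\<in>u. k j))
           * (real b - 1) powi (int (\<Sum>j\<in>u. k j) - int m + int t) \<and>
      real b powi (int m - int (\<Sum>j\<in>u. k j))
           * (real b - 1) powi (int (\<Sum>j\<in>u. k j) - int m + int t)
        \<le> real b ^ (t + card u - 1) / (real b - 1) ^ (card u - 1)"
    if u: "u \<noteq> {}" "u \<subseteq> {1..s}" and k: "int m - int t - int (card u) < int (\<Sum>j\<in>u. k j)"
      "int (\<Sum>j\<in>u. k j) \<le> int m - int t" for u k
  proof -
    define d where "d = m - t - (\<Sum>j\<in>u. k j)"
    have d: "m = t + (\<Sum>j\<in>u. k j) + d" "d < card u"
      using k unfolding d_def by linarith+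
    have "int m - int (\<Sum>j\<in>u. k j) = int (t + d)"
      "int (\<Sum>j\<in>u. k j) - int m + int t = - int d"
      using d(1) by auto
    hence eq: "real b powi (int m - int (\<Sum>j\<in>u. k j))
        * (real b - 1) powi (int (\<Sum>j\<in>u. k j) - int m + int t)
        = real b ^ (t + d) / (real b - 1) ^ d"
      by (simp only: power_int_minus power_int_of_nat divide_inverse)
    \<comment> \<open>Refining exactly \<open>d\<close> coordinates brings the total level to \<open>m - t\<close>.\<close>
    obtain e where e: "e \<subseteq> u" "card e = d"
      using d(2) obtain_subset_with_card_n[of d u] by auto
    have "t + card u - 1 = t + (card u - 1)"
      using d(2) by simp
    thus ?thesis
      unfolding eq using gain_bound_mono[OF b, of d "card u - 1" t] d
        gain_coeff_net_le[OF net b \<open>s \<ge> 1\<close> u(2) e(1), of k] e(2) \<open>N = b ^ m\<close> by simp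
  qed
  have "gain_coeff b N x u k \<le> real b ^ (t + s - 1) / (real b - 1) ^ (s - 1)"
    if u: "u \<noteq> {}" "u \<subseteq> {1..s}" for u k
  proof -
    have fin: "finite u"
      using u(2) finite_subset by blast
    have cu: "card u > 0" "card u \<le> s"
      using u fin card_mono[OF _ u(2)] by (auto simp: card_gt_0_iff)
    have shift: "t + card u - 1 = t + (card u - 1)" "t + s - 1 = t + (s - 1)"
      using cu by auto
    have up: "real b ^ (t + d) / (real b - 1) ^ d \<le> real b ^ (t + s - 1) / (real b - 1) ^ (s - 1)"
      if "d \<le> s - 1" for d
      unfolding shift by (rule gain_bound_mono[OF b that])
    consider "int (\<Sum>j\<in>u. k j) \<le> int m - int t - int (card u)"
      | "int m - int t - int (card u) < int (\<Sum>j\<in>u. k j)" "int (\<Sum>j\<in>u. k j) \<le> int m - int t"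
      | "int (\<Sum>j\<in>u. k j) > int m - int t"
      by linarith
    thus ?thesis
    proof cases
      case 1
      have "0 \<le> real b ^ (t + s - 1) / (real b - 1) ^ (s - 1)"
        using b by simp
      with i[OF u 1] show ?thesis by linarith
    next
      case 2
      from ii[OF u 2] up[of "card u - 1"] cu show ?thesis
        unfolding shift(1) by linarith
    next
      case 3
      from iii[OF u 3] up[of 0] show ?thesis by simp
    qed
  qed
  moreover obtain u k where "u \<noteq> {}" "u \<subseteq> {1..s}" "max_gain b N s x = gain_coeff b N x u k"
    using max_gain_attained(1)[OF \<open>s \<ge> 1\<close>, of b N x] by blast
  ultimately have max_le: "max_gain b N s x \<le> real b ^ (t + s - 1) / (real b - 1) ^ (s - 1)"
    by simp
  show ?thesis
  proof (intro conjI allI impI, goal_cases)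
    case (1 u k)
    thus ?case by (rule i)
  next
    case (2 u k)
    show ?case by (rule ii[THEN conjunct1]) (use 2 in blast)+
  next
    case (3 u k)
    show ?case by (rule ii[THEN conjunct2]) (use 3 in blast)+
  next
    case (4 u k)
    thus ?case by (rule iii)
  qed (rule max_le)
qed

end
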